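(* Let $L=\mathfrak{n}_3$ be the three-dimensional Heisenberg Lie algebra over $\mathbb{C}$, with basis $e_1,e_2,e_3$ and bracket $\mu_0$ given by $\mu_0(e_2,e_3)=e_1$, $\mu_0(e_3,e_2)=-e_1$, all other brackets of basis elements being zero, regarded as a Leibniz algebra. Let $\bar\phi_1,\dots,\bar\phi_8:L\otimes L\to L$ be the bilinear maps (only nonzero values on pairs of basis vectors are listed) \begin{align*} &\bar\phi_1(e_2,e_3)=e_3,\ \bar\phi_1(e_3,e_2)=-e_3;\\ &\bar\phi_2(e_1,e_2)=e_2,\ \bar\phi_2(e_2,e_1)=-e_2,\ \bar\phi_2(e_1,e_3)=-e_3,\ \bar\phi_2(e_3,e_1)=e_3;\\ &\bar\phi_3(e_1,e_2)=e_3,\ \bar\phi_3(e_2,e_1)=-e_3;\\ &\bar\phi_4(e_1,e_3)=e_1,\ \bar\phi_4(e_3,e_1)=-e_1;\\ &\bar\phi_5(e_1,e_3)=e_2,\ \bar\phi_5(e_3,e_1)=-e_2;\\ &\bar\phi_6(e_2,e_2)=e_1;\\ &\bar\phi_7(e_3,e_2)=e_1;\\ &\bar\phi_8(e_3,e_3)=e_1. \end{align*} Then: (a) The brackets $\mu_0+t\bar\phi_i$, $1\le i\le 8$, define eight pairwise non-equivalent infinitesimal Leibniz deformations of $L$ (with base $\mathbb{C}[t]/(t^2)$). (b) $[\bar\phi_i,\bar\phi_i]=0$ for $i=1,\dots,8$, and each one-parameter deformation $\mu_0+t\bar\phi_i$ is a real deformation, i.e. it satisfies the Leibniz identity exactly,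 to all orders in $t$. (c) The deformations $\mu_0+t\bar\phi_i$ with $1\le i\le 5$ are Lie algebra deformations, while the three deformations $\mu_0+t\bar\phi_6$, $\mu_0+t\bar\phi_7$, $\mu_0+t\bar\phi_8$ are Leibniz deformations which are not Lie algebras (for $t\neq 0$), and these three are nilpotent Leibniz algebras.
   Context: A Leibniz algebra over a commutative ring $A$ is an $A$-module with an $A$-bilinear bracket satisfying $[x,[y,z]]=[[x,y],z]-[[x,z],y]$. Every Lie algebra is a Leibniz algebra. A Leibniz algebra $L$ is nilpotent if $L^n=0$ for some $n$, where $L^1=L$, $L^{k+1}=[L^k,L]$. A deformation of a Leibniz algebra $L$ over $\mathbb{C}$ with base a commutative $\mathbb{C}$-algebra $A$ with augmentation $\varepsilon:A\to\mathbb{C}$ and maximal ideal $\mathfrak{M}=\ker\varepsilon$ is an $A$-Leibniz algebra structure on $A\otimes L$ such that $\varepsilon\otimes \mathrm{id}:A\otimes L\to \mathbb{C}\otimes L=L$ is a Leibniz algebra homomorphism. It is infinitesimal if $\mathfrak{M}^2=0$. Two deformations with the same base $A$ are equivalent if there is an $A$-Leibniz algebra isomorphism between them that is compatible with $\varepsilon\otimes\mathrm{id}$ (i.e. induces the identity on $L$). The bracket $\mu_0+t\phi$ means the one extending $(x,y)\mapsto \mu_0(x,y)+t\phi(x,y)$ for $x,y\in L$. For bilinear maps $\alpha,\beta:L\otimes L\to L$, the bracket of $2$-cochains is $[\alpha,\beta]=\alpha\circ\beta+\beta\circ\alpha$, where $$(\alpha\circ\beta)(x,y,z)=\alpha(\beta(x,y),z)-\alpha(\beta(x,z),y)-\alpha(x,\beta(y,z)).$$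 *)

theory Defs
  imports "HOL-Analysis.Analysis" "HOL-Computational_Algebra.Formal_Power_Series"
begin

section \<open>Leibniz and Lie algebras over a commutative ring\<close>

definition bilinear_map ::
    "('a::comm_ring_1 \<Rightarrow> 'b::ab_group_add \<Rightarrow> 'b) \<Rightarrow> ('b \<Rightarrow> 'b \<Rightarrow> 'b) \<Rightarrow> bool" where
  "bilinear_map smul br \<longleftrightarrow>
     (\<forall>y. module_hom smul smul (\<lambda>x. br x y)) \<and> (\<forall>x. module_hom smul smul (br x))"

locale leibniz_algebra = module smul
  for smul :: "'a::comm_ring_1 \<Rightarrow> 'b::ab_group_add \<Rightarrow> 'b" +
  fixes br :: "'b \<Rightarrow> 'b \<Rightarrow> 'b"
  assumes bilinear: "bilinear_map smul br"
    and leibniz: "br x (br y z) = br (br x y) z - br (br x z) y"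

locale lie_algebra = module smul
  for smul :: "'a::comm_ring_1 \<Rightarrow> 'b::ab_group_add \<Rightarrow> 'b" +
  fixes br :: "'b \<Rightarrow> 'b \<Rightarrow> 'b"
  assumes bilinear: "bilinear_map smul br"
    and alternating: "br x x = 0"
    and jacobi: "br x (br y z) + br y (br z x) + br z (br x y) = 0"

definition leibniz_hom ::
    "('a::comm_ring_1 \<Rightarrow> 'b::ab_group_add \<Rightarrow> 'b) \<Rightarrow> ('b \<Rightarrow> 'b \<Rightarrow> 'b) \<Rightarrow>
     ('a \<Rightarrow> 'c::ab_group_add \<Rightarrow> 'c) \<Rightarrow> ('c \<Rightarrow> 'c \<Rightarrow> 'c) \<Rightarrow> ('b \<Rightarrow> 'c) \<Rightarrow> bool" where
  "leibniz_hom smul1 br1 smul2 br2 f \<longleftrightarrow>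
     module_hom smul1 smul2 f \<and> (\<forall>x y. f (br1 x y) = br2 (f x) (f y))"

text \<open>The index is shifted: \<open>lower_central smul br k\<close> is $L^{k+1}$, where $L^1 = L$ and
  $L^{k+1} = [L^k, L]$ is the submodule generated by the brackets.\<close>

primrec lower_central ::
    "('a::comm_ring_1 \<Rightarrow> 'b::ab_group_add \<Rightarrow> 'b) \<Rightarrow> ('b \<Rightarrow> 'b \<Rightarrow> 'b) \<Rightarrow> nat \<Rightarrow> 'b set" where
  "lower_central smul br 0 = UNIV"
| "lower_central smul br (Suc k) =
     module.span smul {br x y |x y. x \<in> lower_central smul br k}"

definition nilpotent_leibniz ::
    "('a::comm_ring_1 \<Rightarrow> 'b::ab_group_add \<Rightarrow> 'b) \<Rightarrow> ('b \<Rightarrow> 'b \<Rightarrow> 'b) \<Rightarrow> bool" where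
  "nilpotent_leibniz smul br \<longleftrightarrow>
     leibniz_algebra smul br \<and> (\<exists>n. lower_central smul br n = {0})"

section \<open>Deformations over an augmented commutative \<open>\<complex>\<close>-algebra\<close>

text \<open>A commutative \<open>\<complex>\<close>-algebra \<open>A\<close> is a commutative ring with a ring homomorphism
  \<open>\<eta> : \<complex> \<rightarrow> A\<close>; an augmentation is a ring homomorphism \<open>\<epsilon> : A \<rightarrow> \<complex>\<close> with \<open>\<epsilon> \<circ> \<eta> = id\<close>.\<close>

locale augmented_algebra =
  fixes \<eta> :: "complex \<Rightarrow> 'a::comm_ring_1" and \<epsilon> :: "'a \<Rightarrow> complex"
  assumes unit_add: "\<eta> (c + d) = \<eta> c + \<eta> d"
    and unit_mult: "\<eta> (c * d) = \<eta> c * \<eta> d"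
    and unit_one: "\<eta> 1 = 1"
    and aug_add: "\<epsilon> (a + b) = \<epsilon> a + \<epsilon> b"
    and aug_mult: "\<epsilon> (a * b) = \<epsilon> a * \<epsilon> b"
    and aug_unit: "\<epsilon> (\<eta> c) = c"

definition infinitesimal_base :: "('a::comm_ring_1 \<Rightarrow> complex) \<Rightarrow> bool" where
  "infinitesimal_base \<epsilon> \<longleftrightarrow> (\<forall>a b. \<epsilon> a = 0 \<longrightarrow> \<epsilon> b = 0 \<longrightarrow> a * b = 0)"

text \<open>For $L = \<complex>^n$, the module $A \otimes L$ is $A^n$.  Applying a map in each coordinate gives
  $\epsilon \otimes id : A^n \to \<complex>^n$ for \<open>f = \<epsilon>\<close>, and the inclusion $L \to A \otimes L$,
  $x \mapsto 1 \otimes x$, for \<open>f = \<eta>\<close>.\<close>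

definition coordwise :: "('a \<Rightarrow> 'b) \<Rightarrow> 'a ^ 'n \<Rightarrow> 'b ^ 'n" where
  "coordwise f x = (\<chi> i. f (x $ i))"

definition leibniz_deformation ::
    "(complex \<Rightarrow> 'a::comm_ring_1) \<Rightarrow> ('a \<Rightarrow> complex) \<Rightarrow>
     (complex ^ 'n \<Rightarrow> complex ^ 'n \<Rightarrow> complex ^ 'n) \<Rightarrow>
     ('a ^ 'n \<Rightarrow> 'a ^ 'n \<Rightarrow> 'a ^ 'n) \<Rightarrow> bool" where
  "leibniz_deformation \<eta> \<epsilon> \<mu> \<nu> \<longleftrightarrow>
     augmented_algebra \<eta> \<epsilon> \<and> leibniz_algebra (*s) \<mu> \<and> leibniz_algebra (*s) \<nu> \<and>
     leibniz_hom (\<lambda>c x. \<eta> c *s x) \<nu> (*s) \<mu> (coordwise \<epsilon>)"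

definition infinitesimal_deformation ::
    "(complex \<Rightarrow> 'a::comm_ring_1) \<Rightarrow> ('a \<Rightarrow> complex) \<Rightarrow>
     (complex ^ 'n \<Rightarrow> complex ^ 'n \<Rightarrow> complex ^ 'n) \<Rightarrow>
     ('a ^ 'n \<Rightarrow> 'a ^ 'n \<Rightarrow> 'a ^ 'n) \<Rightarrow> bool" where
  "infinitesimal_deformation \<eta> \<epsilon> \<mu> \<nu> \<longleftrightarrow>
     leibniz_deformation \<eta> \<epsilon> \<mu> \<nu> \<and> infinitesimal_base \<epsilon>"

definition equivalent_deformations ::
    "('a::comm_ring_1 \<Rightarrow> complex) \<Rightarrow>
     ('a ^ 'n \<Rightarrow> 'a ^ 'n \<Rightarrow> 'a ^ 'n) \<Rightarrow> ('a ^ 'n \<Rightarrow> 'a ^ 'n \<Rightarrow> 'a ^ 'n) \<Rightarrow> bool" where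
  "equivalent_deformations \<epsilon> \<nu> \<nu>' \<longleftrightarrow>
     (\<exists>f. bij f \<and> leibniz_hom (*s) \<nu> (*s) \<nu>' f \<and>
          (\<forall>x. coordwise \<epsilon> (f x) = coordwise \<epsilon> x))"

text \<open>The \<open>A\<close>-bilinear map on \<open>A\<^sup>n\<close> with prescribed values on pairs of basis vectors.\<close>

definition bilinear_of :: "('n \<Rightarrow> 'n \<Rightarrow> 'a ^ 'n) \<Rightarrow> 'a::comm_ring_1 ^ 'n \<Rightarrow> 'a ^ 'n \<Rightarrow> 'a ^ 'n" where
  "bilinear_of c x y = (\<Sum>i\<in>UNIV. \<Sum>j\<in>UNIV. (x $ i * y $ j) *s c i j)"

text \<open>The bracket \<open>\<mu> + t \<phi>\<close> on \<open>A\<^sup>n\<close>, for \<open>t \<in> A\<close>: the \<open>A\<close>-bilinear extension of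
  \<open>(x, y) \<mapsto> \<mu>(x, y) + t \<phi>(x, y)\<close>, \<open>x, y \<in> L\<close>.\<close>

definition perturbed ::
    "(complex \<Rightarrow> 'a::comm_ring_1) \<Rightarrow> 'a \<Rightarrow>
     (complex ^ 'n \<Rightarrow> complex ^ 'n \<Rightarrow> complex ^ 'n) \<Rightarrow>
     (complex ^ 'n \<Rightarrow> complex ^ 'n \<Rightarrow> complex ^ 'n) \<Rightarrow>
     'a ^ 'n \<Rightarrow> 'a ^ 'n \<Rightarrow> 'a ^ 'n" where
  "perturbed \<eta> t \<mu> \<phi> =
     bilinear_of (\<lambda>i j. coordwise \<eta> (\<mu> (axis i 1) (axis j 1)) +
                       t *s coordwise \<eta> (\<phi> (axis i 1) (axis j 1)))"

definition cochain_comp :: "('b::ab_group_add \<Rightarrow> 'b \<Rightarrow> 'b) \<Rightarrow> ('b \<Rightarrow> 'b \<Rightarrow> 'b) \<Rightarrow> 'b \<Rightarrow> 'b \<Rightarrow> 'b \<Rightarrow> 'b" where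
  "cochain_comp \<alpha> \<beta> x y z = \<alpha> (\<beta> x y) z - \<alpha> (\<beta> x z) y - \<alpha> x (\<beta> y z)"

definition cochain_bracket :: "('b::ab_group_add \<Rightarrow> 'b \<Rightarrow> 'b) \<Rightarrow> ('b \<Rightarrow> 'b \<Rightarrow> 'b) \<Rightarrow> 'b \<Rightarrow> 'b \<Rightarrow> 'b \<Rightarrow> 'b" where
  "cochain_bracket \<alpha> \<beta> x y z = cochain_comp \<alpha> \<beta> x y z + cochain_comp \<beta> \<alpha> x y z"

section \<open>The ring \<open>\<complex>[t]/(t\<^sup>2)\<close>\<close>

quotient_type dual = "complex poly" / "\<lambda>p q. [:0, 1:]\<^sup>2 dvd p - q"
proof (rule equivpI)
  show "reflp (\<lambda>p q :: complex poly. [:0, 1:]\<^sup>2 dvd p - q)"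
    by (rule reflpI) simp
  show "symp (\<lambda>p q :: complex poly. [:0, 1:]\<^sup>2 dvd p - q)"
    by (rule sympI) (simp only: dvd_diff_commute)
  show "transp (\<lambda>p q :: complex poly. [:0, 1:]\<^sup>2 dvd p - q)"
    by (rule transpI) (drule (1) dvd_add, simp)
qed

instantiation dual :: comm_ring_1
begin

lift_definition zero_dual :: dual is 0 .
lift_definition one_dual :: dual is 1 .
lift_definition plus_dual :: "dual \<Rightarrow> dual \<Rightarrow> dual" is "(+)"
  by (drule (1) dvd_add) (simp add: algebra_simps)
lift_definition minus_dual :: "dual \<Rightarrow> dual \<Rightarrow> dual" is "(-)"
  by (drule (1) dvd_diff) (simp add: algebra_simps)
lift_definition uminus_dual :: "dual \<Rightarrow> dual" is uminus
  by (simp only: minus_diff_minus dvd_minus_iff)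
lift_definition times_dual :: "dual \<Rightarrow> dual \<Rightarrow> dual" is "(*)"
  by (simp only: mult_diff_mult dvd_add dvd_mult dvd_mult2)

instance
proof
  show "(0::dual) \<noteq> 1"
  proof (transfer, rule notI)
    assume "[:0, 1:]\<^sup>2 dvd (0 - 1 :: complex poly)"
    then have "is_unit ([:0, 1:]\<^sup>2 :: complex poly)"
      by simp
    then show False
      by (simp add: is_unit_power_iff is_unit_pCons_iff)
  qed
qed (transfer; simp add: algebra_simps)+

end

lift_definition dual_unit :: "complex \<Rightarrow> dual" is "\<lambda>c. [:c:]" .

lift_definition dual_aug :: "dual \<Rightarrow> complex" is "\<lambda>p. poly p 0"
proof -
  fix p q :: "complex poly"
  assume "[:0, 1:]\<^sup>2 dvd p - q"
  then have "poly (p - q) 0 = 0"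
    by (elim dvdE) (simp only: poly_mult, simp)
  then show "poly p 0 = poly q 0"
    by simp
qed

lift_definition dual_t :: dual is "[:0, 1:]" .

section \<open>The Heisenberg algebra and the cochains\<close>

abbreviation e :: "3 \<Rightarrow> complex ^ 3" where
  "e k \<equiv> axis k 1"

definition bilinear_of_table ::
    "((3 \<times> 3) \<times> (complex ^ 3)) list \<Rightarrow> complex ^ 3 \<Rightarrow> complex ^ 3 \<Rightarrow> complex ^ 3" where
  "bilinear_of_table ps =
     bilinear_of (\<lambda>i j. case map_of ps (i, j) of None \<Rightarrow> 0 | Some v \<Rightarrow> v)"

definition heisenberg :: "complex ^ 3 \<Rightarrow> complex ^ 3 \<Rightarrow> complex ^ 3" where
  "heisenberg = bilinear_of_table [((2, 3), e 1), ((3, 2), - e 1)]"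

text \<open>\<open>phi i\<close> is meant for \<open>1 \<le> i \<le> 8\<close> only.\<close>

definition phi :: "nat \<Rightarrow> complex ^ 3 \<Rightarrow> complex ^ 3 \<Rightarrow> complex ^ 3" where
  "phi i = bilinear_of_table
    ([[((2, 3), e 3), ((3, 2), - e 3)],
      [((1, 2), e 2), ((2, 1), - e 2), ((1, 3), - e 3), ((3, 1), e 3)],
      [((1, 2), e 3), ((2, 1), - e 3)],
      [((1, 3), e 1), ((3, 1), - e 1)],
      [((1, 3), e 2), ((3, 1), - e 2)],
      [((2, 2), e 1)],
      [((3, 2), e 1)],
      [((3, 3), e 1)]] ! (i - 1))"

text \<open>The bracket \<open>\<mu>\<^sub>0 + t \<phi>\<^sub>i\<close> with \<open>t\<close> the parameter of \<open>\<complex>[t]/(t\<^sup>2)\<close>, \<open>\<complex>[t]\<close>, \<open>\<complex>[[t]]\<close>,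
  and with \<open>t\<close> a complex number.\<close>

definition def_dual :: "nat \<Rightarrow> dual ^ 3 \<Rightarrow> dual ^ 3 \<Rightarrow> dual ^ 3" where
  "def_dual i = perturbed dual_unit dual_t heisenberg (phi i)"

definition def_poly :: "nat \<Rightarrow> complex poly ^ 3 \<Rightarrow> complex poly ^ 3 \<Rightarrow> complex poly ^ 3" where
  "def_poly i = perturbed (\<lambda>c. [:c:]) [:0, 1:] heisenberg (phi i)"

definition def_fps :: "nat \<Rightarrow> complex fps ^ 3 \<Rightarrow> complex fps ^ 3 \<Rightarrow> complex fps ^ 3" where
  "def_fps i = perturbed fps_const fps_X heisenberg (phi i)"

definition def_at :: "complex \<Rightarrow> nat \<Rightarrow> complex ^ 3 \<Rightarrow> complex ^ 3 \<Rightarrow> complex ^ 3" where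
  "def_at t i x y = heisenberg x y + t *s phi i x y"

end

theory Submission
  imports Defs
begin

text \<open>
  Two ideas carry the proof.

  All bracket identities are proved for the homogeneous pencil \<open>s \<mu>\<^sub>0 + t \<phi>\<^sub>i\<close> over an arbitrary
  commutative ring, with \<open>s\<close> and \<open>t\<close> arbitrary elements (\<open>leibniz_pencil\<close>, \<open>lie_pencil\<close>,
  \<open>not_lie_pencil\<close>, \<open>nilpotent_pencil\<close>).  The Leibniz identity is quadratic in the bracket, so for
  indeterminate \<open>s\<close> and \<open>t\<close> it says at once that \<open>[\<mu>\<^sub>0, \<mu>\<^sub>0]\<close>, \<open>[\<mu>\<^sub>0, \<phi>\<^sub>i]\<close> and \<open>[\<phi>\<^sub>i, \<phi>\<^sub>i]\<close> vanish.
  Taking \<open>(s, t) = (0, 1)\<close> gives \<open>[\<phi>\<^sub>i, \<phi>\<^sub>i] = 0\<close>, and taking \<open>s = 1\<close> gives the deformed bracket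
  over the dual numbers, the polynomials, the power series and \<open>\<complex>\<close> alike.  For \<open>i \<ge> 6\<close> every bracket
  is a multiple of the central vector \<open>e\<^sub>1\<close>, hence all double brackets vanish, while
  the square of \<open>e\<^sub>2 + e\<^sub>3\<close> is \<open>t e\<^sub>1\<close>, which rules out a Lie algebra
  when \<open>t \<noteq> 0\<close>.

  Non-equivalence is a statement about cohomology.  An equivalence over the dual numbers has the form
  \<open>1 + t g\<close>, and comparing coefficients of \<open>t\<close> shows that the difference of the two cochains is the
  coboundary of \<open>g\<close> (\<open>equivalent_imp_cohomologous\<close>).  Eight linear functionals on cochains vanish on
  the coboundaries of the Heisenberg algebra (\<open>class_coord_coboundary\<close>) and form a dual family to
  \<open>\<phi>\<^sub>1, \<dots>, \<phi>\<^sub>8\<close> (\<open>class_coord_phi\<close>).  So the classes of the \<open>\<phi>\<^sub>i\<close> are linearly independent, and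
  in particular distinct.
\<close>

section \<open>Bilinear maps on free modules\<close>

lemma module_vec: "module ((*s) :: 'a::comm_ring_1 \<Rightarrow> 'a ^ 'n \<Rightarrow> 'a ^ 'n)"
  by unfold_locales (simp_all add: vec_eq_iff algebra_simps)

lemma module_homI_vec:
  fixes f :: "'a::comm_ring_1 ^ 'n \<Rightarrow> 'a ^ 'm"
  assumes "\<And>x y. f (x + y) = f x + f y" "\<And>c x. f (c *s x) = c *s f x"
  shows "module_hom (*s) (*s) f"
  by (simp add: module_hom_def module_hom_axioms_def module_vec assms)

lemma bilinear_bilinear_of: "bilinear_map (*s) (bilinear_of c)"
  unfolding bilinear_map_def bilinear_of_def
  by (intro allI conjI module_homI_vec)
    (simp_all add: vec_eq_iff algebra_simps sum.distrib sum_distrib_left)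

lemma bilinear_of_axis: "bilinear_of c (axis i 1) (axis j 1) = c i j"
proof -
  have "bilinear_of c (axis i 1) (axis j 1)
      = (\<Sum>k\<in>UNIV. \<Sum>l\<in>UNIV. if l = j then if k = i then c k l else 0 else 0)"
    unfolding bilinear_of_def axis_def by (intro sum.cong refl) (auto simp: vec_eq_iff)
  then show ?thesis by simp
qed

lemma bilinear_map_eq_bilinear_of:
  assumes "bilinear_map (*s) \<mu>"
  shows "bilinear_of (\<lambda>i j. \<mu> (axis i 1) (axis j 1)) = \<mu>"
proof (intro ext)
  fix x y
  have l: "module_hom (*s) (*s) (\<lambda>x. \<mu> x y)" and r: "module_hom (*s) (*s) (\<mu> x)" for x y
    using assms by (auto simp: bilinear_map_def)
  have b: "z = (\<Sum>i\<in>UNIV. z $ i *s axis i 1)" for z :: "'a ^ 'b"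
    by (simp add: vec_eq_iff axis_def if_distrib cong: if_cong)
  have "\<mu> x y = \<mu> (\<Sum>i\<in>UNIV. x $ i *s axis i 1) (\<Sum>j\<in>UNIV. y $ j *s axis j 1)"
    using b[of x] b[of y] by simp
  also have "\<dots> = (\<Sum>j\<in>UNIV. \<Sum>i\<in>UNIV. (x $ i * y $ j) *s \<mu> (axis i 1) (axis j 1))"
    by (simp add: module_hom.sum[OF l] module_hom.sum[OF r]
        module_hom.scale[OF l] module_hom.scale[OF r] vec_eq_iff sum_distrib_left ac_simps)
  also have "\<dots> = bilinear_of (\<lambda>i j. \<mu> (axis i 1) (axis j 1)) x y"
    unfolding bilinear_of_def by (rule sum.swap)
  finally show "bilinear_of (\<lambda>i j. \<mu> (axis i 1) (axis j 1)) x y = \<mu> x y" by simp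
qed

text \<open>The vectors that annihilate everything from the left form a submodule, so they contain the
  submodule generated by the brackets as soon as they contain the brackets.\<close>

lemma nilpotent_if_two_step:
  fixes br :: "'a::comm_ring_1 ^ 'n \<Rightarrow> 'a ^ 'n \<Rightarrow> 'a ^ 'n"
  assumes L: "leibniz_algebra (*s) br"
    and two_step: "\<And>x y z. br (br x y) z = 0"
  shows "nilpotent_leibniz (*s) br"
proof -
  interpret m: module "(*s) :: 'a \<Rightarrow> 'a ^ 'n \<Rightarrow> 'a ^ 'n" by (rule module_vec)
  have hom: "module_hom (*s) (*s) (\<lambda>x. br x z)" for z
    using leibniz_algebra.bilinear[OF L] by (auto simp: bilinear_map_def)
  have "m.subspace {u. \<forall>z. br u z = 0}"
    by (rule m.subspaceI)
      (auto simp: module_hom.add[OF hom] module_hom.scale[OF hom] module_hom.zero[OF hom])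
  then have "m.span {br x y |x y. x \<in> UNIV} \<subseteq> {u. \<forall>z. br u z = 0}"
    by (intro m.span_minimal) (auto simp: two_step)
  then have "{br x y |x y. x \<in> lower_central (*s) br 1} \<subseteq> {0}"
    by auto
  then have "m.span {br x y |x y. x \<in> lower_central (*s) br 1} \<subseteq> {0}"
    by (intro m.span_minimal m.subspaceI) auto
  then have "lower_central (*s) br 2 \<subseteq> {0}"
    by (simp add: numeral_2_eq_2)
  moreover have "0 \<in> lower_central (*s) br 2"
    by (simp add: numeral_2_eq_2 m.span_zero)
  ultimately have "lower_central (*s) br 2 = {0}"
    by blast
  then show ?thesis using L by (auto simp: nilpotent_leibniz_def)
qed

section \<open>Scalar extension along an augmentation\<close>

context augmented_algebra
begin

lemma unit_zero [simp]: "\<eta> 0 = 0"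
  using unit_add[of 0 0] by simp

lemma unit_minus: "\<eta> (- c) = - \<eta> c"
  using unit_add[of c "- c"] by (simp add: eq_neg_iff_add_eq_0 add.commute)

lemma aug_zero [simp]: "\<epsilon> 0 = 0"
  using aug_add[of 0 0] by simp

lemma aug_sum: "\<epsilon> (sum f S) = (\<Sum>x\<in>S. \<epsilon> (f x))"
  by (induction S rule: infinite_finite_induct) (simp_all add: aug_add)

text \<open>Modulo the augmentation ideal, which contains \<open>t\<close>, the perturbation is invisible.\<close>

lemma coordwise_aug_perturbed:
  assumes "bilinear_map (*s) \<mu>" "\<epsilon> t = 0"
  shows "coordwise \<epsilon> (perturbed \<eta> t \<mu> \<phi> u v) = \<mu> (coordwise \<epsilon> u) (coordwise \<epsilon> v)"
proof -
  have "coordwise \<epsilon> (perturbed \<eta> t \<mu> \<phi> u v) =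
      bilinear_of (\<lambda>i j. \<mu> (axis i 1) (axis j 1)) (coordwise \<epsilon> u) (coordwise \<epsilon> v)"
    by (simp add: perturbed_def bilinear_of_def coordwise_def vec_eq_iff aug_sum aug_add aug_mult
        aug_unit assms(2))
  then show ?thesis by (simp add: bilinear_map_eq_bilinear_of[OF assms(1)])
qed

lemma leibniz_deformation_perturbed:
  assumes "leibniz_algebra (*s) \<mu>" "leibniz_algebra (*s) (perturbed \<eta> t \<mu> \<phi>)" "\<epsilon> t = 0"
  shows "leibniz_deformation \<eta> \<epsilon> \<mu> (perturbed \<eta> t \<mu> \<phi>)"
proof -
  have "module (\<lambda>c x. \<eta> c *s x)"
    by unfold_locales (simp_all add: vec_eq_iff algebra_simps unit_add unit_mult unit_one)
  then have "module_hom (\<lambda>c x. \<eta> c *s x) (*s) (coordwise \<epsilon>)"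
    by (auto simp: module_hom_def module_hom_axioms_def module_vec coordwise_def vec_eq_iff
        aug_add aug_mult aug_unit)
  then show ?thesis
    using assms augmented_algebra_axioms
    by (simp add: leibniz_deformation_def leibniz_hom_def coordwise_aug_perturbed
        leibniz_algebra.bilinear)
qed

end

section \<open>The dual numbers and equivalence of infinitesimal deformations\<close>

text \<open>The coefficient of \<open>t\<close>, a derivation over the augmentation.  Applying it coordinatewise replaces
  the comparison of coefficients of \<open>t\<close>.\<close>

lift_definition dual_coeff :: "dual \<Rightarrow> complex" is "\<lambda>p. coeff p 1"
proof -
  fix p q :: "complex poly"
  assume "[:0, 1:]\<^sup>2 dvd p - q"
  then have "coeff (p - q) 1 = 0"
    by (elim dvdE) (simp add: power2_eq_square coeff_pCons)
  then show "coeff p 1 = coeff q 1" by simp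
qed

lemma dual_coeff_simps:
  "dual_coeff (a + b) = dual_coeff a + dual_coeff b"
  "dual_coeff (a * b) = dual_coeff a * dual_aug b + dual_aug a * dual_coeff b"
  "dual_coeff (dual_unit c) = 0" "dual_coeff dual_t = 1" "dual_coeff 0 = 0"
  by (transfer; simp add: coeff_mult poly_0_coeff_0)+

lemma dual_coeff_sum: "dual_coeff (sum f S) = (\<Sum>x\<in>S. dual_coeff (f x))"
  by (induction S rule: infinite_finite_induct) (simp_all add: dual_coeff_simps)

lemma dual_aug_t: "dual_aug dual_t = 0"
  by transfer simp

lemma dual_decomposition: "a = dual_unit (dual_aug a) + dual_t * dual_unit (dual_coeff a)"
proof (transfer)
  fix p :: "complex poly"
  obtain a b q where p: "p = pCons a (pCons b q)"
    by (metis pCons_cases)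
  have "p - ([:poly p 0:] + [:0, 1:] * [:coeff p 1:]) = [:0, 1:]\<^sup>2 * q"
    by (simp add: p power2_eq_square)
  then show "[:0, 1:]\<^sup>2 dvd p - ([:poly p 0:] + [:0, 1:] * [:coeff p 1:])"
    by simp
qed

interpretation dual: augmented_algebra dual_unit dual_aug
  by (unfold_locales; (transfer, simp add: one_pCons))

lemma infinitesimal_base_dual: "infinitesimal_base dual_aug"
  unfolding infinitesimal_base_def
  by (metis dual_decomposition dual.aug_mult dual.unit_zero dual_coeff_simps(2) mult_zero_left
      mult_zero_right add_0)

text \<open>The product rule for the bilinear bracket: the coefficient of \<open>t\<close> comes from one of the
  two arguments or from the structure constants.\<close>

lemma coordwise_coeff_perturbed:
  assumes "bilinear_map (*s) \<mu>" "bilinear_map (*s) \<phi>"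
  shows "coordwise dual_coeff (perturbed dual_unit dual_t \<mu> \<phi> u v) =
    \<mu> (coordwise dual_coeff u) (coordwise dual_aug v) +
    \<mu> (coordwise dual_aug u) (coordwise dual_coeff v) +
    \<phi> (coordwise dual_aug u) (coordwise dual_aug v)"
proof -
  let ?D = "coordwise dual_coeff" and ?E = "coordwise dual_aug"
  let ?\<mu> = "bilinear_of (\<lambda>i j. \<mu> (axis i 1) (axis j 1))"
    and ?\<phi> = "bilinear_of (\<lambda>i j. \<phi> (axis i 1) (axis j 1))"
  have "?D (perturbed dual_unit dual_t \<mu> \<phi> u v) =
      ?\<mu> (?D u) (?E v) + ?\<mu> (?E u) (?D v) + ?\<phi> (?E u) (?E v)"
    by (simp add: perturbed_def bilinear_of_def coordwise_def vec_eq_iff dual_coeff_sum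
        dual_coeff_simps dual.aug_add dual.aug_mult dual.aug_unit dual_aug_t sum.distrib[symmetric]
        algebra_simps)
  then show ?thesis by (simp add: bilinear_map_eq_bilinear_of assms)
qed

text \<open>The map \<open>g\<close> is the coefficient of \<open>t\<close> in \<open>f\<close> restricted to \<open>L\<close>.  Since \<open>f\<close> is linear over the dual
  numbers and lifts the identity, it is \<open>1 + t g\<close>, and the coefficient of \<open>t\<close> in the
  equation saying that \<open>f\<close> preserves brackets is the asserted one.\<close>

lemma equivalent_imp_cohomologous:
  fixes \<mu> \<phi> \<psi> :: "complex ^ 'n \<Rightarrow> complex ^ 'n \<Rightarrow> complex ^ 'n"
  assumes bil: "bilinear_map (*s) \<mu>" "bilinear_map (*s) \<phi>" "bilinear_map (*s) \<psi>"
    and equiv: "equivalent_deformations dual_aug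
      (perturbed dual_unit dual_t \<mu> \<phi>) (perturbed dual_unit dual_t \<mu> \<psi>)"
  obtains g where "module_hom (*s) (*s) g"
    "\<And>x y. \<phi> x y - \<psi> x y = \<mu> (g x) y + \<mu> x (g y) - g (\<mu> x y)"
proof -
  let ?D = "coordwise dual_coeff" and ?E = "coordwise dual_aug" and ?U = "coordwise dual_unit"
  let ?\<nu> = "perturbed dual_unit dual_t \<mu> \<phi>" and ?\<nu>' = "perturbed dual_unit dual_t \<mu> \<psi>"
  obtain f where f: "module_hom (*s) (*s) f" "\<And>u v. f (?\<nu> u v) = ?\<nu>' (f u) (f v)"
      "\<And>u. ?E (f u) = ?E u"
    using equiv unfolding equivalent_deformations_def leibniz_hom_def by blast
  define g where "g x = ?D (f (?U x))" for x
  have D: "?D (u + v) = ?D u + ?D v" "?D (a *s u) = dual_coeff a *s ?E u + dual_aug a *s ?D u"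
    for a and u v :: "dual ^ 'n"
    by (simp_all add: coordwise_def vec_eq_iff dual_coeff_simps)
  have U: "?U (x + y) = ?U x + ?U y" "?U (c *s x) = dual_unit c *s ?U x"
      "?E (?U x) = x" "?D (?U x) = 0" for c and x y :: "complex ^ 'n"
    by (simp_all add: coordwise_def vec_eq_iff dual.unit_add dual.unit_mult dual.aug_unit
        dual_coeff_simps)
  have g: "module_hom (*s) (*s) g"
    by (rule module_homI_vec)
      (simp_all add: g_def U D module_hom.add[OF f(1)] module_hom.scale[OF f(1)]
        dual_coeff_simps dual.aug_unit)
  \<comment> \<open>the coefficient of \<open>t\<close> in \<open>1 + t g\<close>, applied to a vector that may itself involve \<open>t\<close>\<close>
  have Df: "?D (f w) = g (?E w) + ?D w" for w
  proof -
    have "w = ?U (?E w) + dual_t *s ?U (?D w)"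
      using dual_decomposition by (simp add: coordwise_def vec_eq_iff)
    then have "?D (f w) = ?D (f (?U (?E w)) + dual_t *s f (?U (?D w)))"
      by (metis module_hom.add[OF f(1)] module_hom.scale[OF f(1)])
    then show ?thesis
      by (simp add: D g_def dual_coeff_simps dual_aug_t f(3) U)
  qed
  have zero: "\<mu> 0 y = 0" "\<mu> x 0 = 0" for x y
    using bil(1) by (auto simp: bilinear_map_def dest: module_hom.zero)
  have "g (\<mu> x y) + \<phi> x y = \<mu> (g x) y + \<mu> x (g y) + \<psi> x y" for x y
  proof -
    have "?D (f (?\<nu> (?U x) (?U y))) = g (\<mu> x y) + \<phi> x y"
      by (simp add: Df coordwise_coeff_perturbed bil dual.coordwise_aug_perturbed dual_aug_t U zero)
    moreover have "?D (?\<nu>' (f (?U x)) (f (?U y))) = \<mu> (g x) y + \<mu> x (g y) + \<psi> x y"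
      by (simp add: coordwise_coeff_perturbed bil f(3) U g_def)
    ultimately show ?thesis by (simp add: f(2))
  qed
  then have "\<phi> x y - \<psi> x y = \<mu> (g x) y + \<mu> x (g y) - g (\<mu> x y)" for x y
    by (simp add: algebra_simps)
  then show thesis using g that by blast
qed

section \<open>The pencils spanned by the Heisenberg bracket and a cochain\<close>

text \<open>The bracket \<open>s \<mu>\<^sub>0 + t \<phi>\<^sub>i\<close>.  Explicit coordinates make each identity below a polynomial identity that
  ring normalisation decides.  All cochains except the last three are alternating, hence
  expressible by the minors \<open>d\<close>.\<close>

definition pencil :: "nat \<Rightarrow> 'a::comm_ring_1 \<Rightarrow> 'a \<Rightarrow> 'a ^ 3 \<Rightarrow> 'a ^ 3 \<Rightarrow> 'a ^ 3" where
  "pencil i s t x y =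
    (let d = (\<lambda>k l. x $ k * y $ l - x $ l * y $ k) in
     s *s vector [d 2 3, 0, 0] +
     t *s ([vector [0, 0, d 2 3],
            vector [0, d 1 2, - d 1 3],
            vector [0, 0, d 1 2],
            vector [d 1 3, 0, 0],
            vector [0, d 1 3, 0],
            vector [x $ 2 * y $ 2, 0, 0],
            vector [x $ 3 * y $ 2, 0, 0],
            vector [x $ 3 * y $ 3, 0, 0]] ! (i - 1)))"

lemma cochain_cases [consumes 1]:
  assumes "i \<in> {1..8::nat}"
  obtains "i = 1" | "i = 2" | "i = 3" | "i = 4" | "i = 5" | "i = 6" | "i = 7" | "i = 8"
proof -
  have "i = 1 \<or> i = 2 \<or> i = 3 \<or> i = 4 \<or> i = 5 \<or> i = 6 \<or> i = 7 \<or> i = 8"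
    using assms by auto
  then show thesis using that by blast
qed

lemma lie_cochain_cases [consumes 1]:
  assumes "i \<in> {1..5::nat}"
  obtains "i = 1" | "i = 2" | "i = 3" | "i = 4" | "i = 5"
proof -
  have "i = 1 \<or> i = 2 \<or> i = 3 \<or> i = 4 \<or> i = 5"
    using assms by auto
  then show thesis using that by blast
qed

lemma leibniz_cochain_cases [consumes 1]:
  assumes "i \<in> {6..8::nat}"
  obtains "i = 6" | "i = 7" | "i = 8"
proof -
  have "i = 6 \<or> i = 7 \<or> i = 8"
    using assms by auto
  then show thesis using that by blast
qed

lemmas pencil_simps = pencil_def Let_def vec_eq_iff forall_3

lemma bilinear_pencil:
  fixes s t :: "'a::comm_ring_1"
  assumes "i \<in> {1..8}"
  shows "bilinear_map (*s) (pencil i s t)"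
  unfolding bilinear_map_def using assms
  by (cases rule: cochain_cases)
    (auto intro!: module_homI_vec simp: pencil_simps algebra_simps)

lemma leibniz_pencil:
  fixes s t :: "'a::comm_ring_1"
  assumes "i \<in> {1..8}"
  shows "leibniz_algebra (*s) (pencil i s t)"
proof -
  have "pencil i s t x (pencil i s t y z) =
      pencil i s t (pencil i s t x y) z - pencil i s t (pencil i s t x z) y" for x y z
    using assms
    by (cases rule: cochain_cases) (simp_all add: pencil_simps algebra_simps)
  then show ?thesis
    by (intro leibniz_algebra.intro leibniz_algebra_axioms.intro module_vec bilinear_pencil assms)
qed

lemma lie_pencil:
  fixes s t :: "'a::comm_ring_1"
  assumes "i \<in> {1..5}"
  shows "lie_algebra (*s) (pencil i s t)"
proof -
  have "pencil i s t x x = 0" for x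
    using assms
    by (cases rule: lie_cochain_cases) (simp_all add: pencil_simps algebra_simps)
  moreover have "pencil i s t x (pencil i s t y z) + pencil i s t y (pencil i s t z x) +
      pencil i s t z (pencil i s t x y) = 0" for x y z
    using assms
    by (cases rule: lie_cochain_cases) (simp_all add: pencil_simps algebra_simps)
  moreover have "bilinear_map (*s) (pencil i s t)"
    using assms by (intro bilinear_pencil) auto
  ultimately show ?thesis
    by (intro lie_algebra.intro lie_algebra_axioms.intro module_vec)
qed

text \<open>The square of \<open>e\<^sub>2 + e\<^sub>3\<close> is \<open>t e\<^sub>1\<close> for all three cochains: the vector \<open>e\<^sub>2\<close> alone would
  do for \<open>\<phi>\<^sub>6\<close> and \<open>e\<^sub>3\<close> for \<open>\<phi>\<^sub>8\<close>, but both have square zero for \<open>\<phi>\<^sub>7\<close>.\<close>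

lemma not_lie_pencil:
  fixes s t :: "'a::comm_ring_1"
  assumes "i \<in> {6..8}" "t \<noteq> 0"
  shows "\<not> lie_algebra (*s) (pencil i s t)"
proof
  assume "lie_algebra (*s) (pencil i s t)"
  then have *: "pencil i s t (vector [0, 1, 1]) (vector [0, 1, 1]) $ 1 = 0"
    by (simp add: lie_algebra.alternating)
  show False
    using assms(1) assms(2) *
    by (cases rule: leibniz_cochain_cases) (simp_all add: pencil_simps)
qed

text \<open>All brackets are multiples of \<open>e\<^sub>1\<close>, which is central.\<close>

lemma nilpotent_pencil:
  fixes s t :: "'a::comm_ring_1"
  assumes "i \<in> {6..8}"
  shows "nilpotent_leibniz (*s) (pencil i s t)"
proof (rule nilpotent_if_two_step)
  show "leibniz_algebra (*s) (pencil i s t)"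
    using assms by (intro leibniz_pencil) auto
  show "pencil i s t (pencil i s t x y) z = 0" for x y z
    using assms
    by (cases rule: leibniz_cochain_cases) (simp_all add: pencil_simps)
qed

lemma (in augmented_algebra) perturbed_eq_pencil:
  assumes "i \<in> {1..8}"
  shows "perturbed \<eta> t heisenberg (phi i) = pencil i 1 t"
proof (intro ext)
  fix x y
  show "perturbed \<eta> t heisenberg (phi i) x y = pencil i 1 t x y"
    using assms
    by (cases rule: cochain_cases)
      (simp_all add: perturbed_def heisenberg_def phi_def bilinear_of_table_def bilinear_of_axis,
        simp_all add: bilinear_of_def sum_3 coordwise_def axis_def unit_minus unit_one pencil_simps
          algebra_simps)
qed

lemma heisenberg_eq_pencil: "heisenberg = pencil i 1 0"
  by (intro ext)
    (simp add: heisenberg_def bilinear_of_table_def bilinear_of_def sum_3 axis_def pencil_simps)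

lemma phi_eq_pencil:
  assumes "i \<in> {1..8}"
  shows "phi i = pencil i 0 1"
proof (intro ext)
  fix x y
  show "phi i x y = pencil i 0 1 x y"
    using assms
    by (cases rule: cochain_cases)
      (simp_all add: phi_def bilinear_of_table_def bilinear_of_def sum_3 axis_def pencil_simps)
qed

lemma def_at_eq_pencil:
  assumes "i \<in> {1..8}"
  shows "def_at t i = pencil i 1 t"
  by (intro ext)
    (simp add: def_at_def heisenberg_eq_pencil[of i] phi_eq_pencil[OF assms] pencil_def Let_def)

lemma leibniz_heisenberg: "leibniz_algebra (*s) heisenberg"
  unfolding heisenberg_eq_pencil[of 1] by (rule leibniz_pencil) simp

lemma cochain_bracket_phi:
  assumes "i \<in> {1..8}"
  shows "cochain_bracket (phi i) (phi i) = (\<lambda>x y z. 0)"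
proof -
  have "leibniz_algebra (*s) (phi i)"
    using leibniz_pencil[OF assms, of 0 1] by (simp add: phi_eq_pencil[OF assms])
  from leibniz_algebra.leibniz[OF this] show ?thesis
    by (intro ext) (simp add: cochain_bracket_def cochain_comp_def)
qed

lemma (in augmented_algebra) leibniz_deformation_phi:
  assumes "i \<in> {1..8}" "\<epsilon> t = 0"
  shows "leibniz_deformation \<eta> \<epsilon> heisenberg (perturbed \<eta> t heisenberg (phi i))"
  by (rule leibniz_deformation_perturbed)
    (simp_all only: leibniz_heisenberg perturbed_eq_pencil[OF assms(1)] leibniz_pencil[OF assms(1)] assms(2))

section \<open>Separating the cohomology classes\<close>

text \<open>For a linear map \<open>g\<close> write \<open>g e\<^sub>1 = a e\<^sub>1 + b e\<^sub>2 + c e\<^sub>3\<close>.  The coboundary of \<open>g\<close> is alternating and sends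
  \<open>(e\<^sub>1, e\<^sub>2)\<close> to \<open>- c e\<^sub>1\<close>, \<open>(e\<^sub>1, e\<^sub>3)\<close> to \<open>b e\<^sub>1\<close> and \<open>(e\<^sub>2, e\<^sub>3)\<close> to a vector with last coordinates
  \<open>- b\<close> and \<open>- c\<close>.  The functionals are chosen to be zero on such maps; in the first and fourth
  the second term cancels the contribution of \<open>g e\<^sub>1\<close>.\<close>

definition class_coord :: "nat \<Rightarrow> (complex ^ 3 \<Rightarrow> complex ^ 3 \<Rightarrow> complex ^ 3) \<Rightarrow> complex" where
  "class_coord i b =
    [b (e 2) (e 3) $ 3 - b (e 1) (e 2) $ 1,
     b (e 1) (e 2) $ 2,
     b (e 1) (e 2) $ 3,
     b (e 1) (e 3) $ 1 + b (e 2) (e 3) $ 2,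
     b (e 1) (e 3) $ 2,
     b (e 2) (e 2) $ 1,
     b (e 2) (e 3) $ 1 + b (e 3) (e 2) $ 1,
     b (e 3) (e 3) $ 1] ! (i - 1)"

lemma class_coord_diff:
  assumes "i \<in> {1..8}"
  shows "class_coord i (\<lambda>x y. b x y - c x y) = class_coord i b - class_coord i c"
  using assms
    by (cases rule: cochain_cases) (simp_all add: class_coord_def)

lemma class_coord_phi:
  assumes "i \<in> {1..8}" "j \<in> {1..8}"
  shows "class_coord i (phi j) = (if i = j then 1 else 0)"
  unfolding phi_eq_pencil[OF assms(2)]
  using assms(1)
  proof (cases rule: cochain_cases)
  qed (use assms(2) in \<open>cases rule: cochain_cases; simp add: class_coord_def pencil_def Let_def axis_def\<close>)+

lemma class_coord_coboundary:
  assumes g: "module_hom (*s) (*s) g" and i: "i \<in> {1..8}"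
  shows "class_coord i (\<lambda>x y. heisenberg (g x) y + heisenberg x (g y) - g (heisenberg x y)) = 0"
proof -
  have comp: "heisenberg x y $ 1 = x $ 2 * y $ 3 - x $ 3 * y $ 2"
      "heisenberg x y $ 2 = 0" "heisenberg x y $ 3 = 0" for x y
    by (simp_all add: heisenberg_eq_pencil[of 1] pencil_def Let_def)
  have basis: "heisenberg (e 2) (e 3) = e 1" "heisenberg (e 3) (e 2) = - e 1"
      "heisenberg (e 1) (e 2) = 0" "heisenberg (e 1) (e 3) = 0"
      "heisenberg (e 2) (e 2) = 0" "heisenberg (e 3) (e 3) = 0"
    by (simp_all add: heisenberg_def bilinear_of_table_def bilinear_of_axis)
  show ?thesis
    using i
    by (cases rule: cochain_cases)
      (simp_all add: class_coord_def basis module_hom.neg[OF g] module_hom.zero[OF g],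
        simp_all add: comp axis_def)
qed

lemma not_equivalent_phi:
  assumes "i \<in> {1..8}" "j \<in> {1..8}" "i \<noteq> j"
  shows "\<not> equivalent_deformations dual_aug (def_dual i) (def_dual j)"
proof
  assume equiv: "equivalent_deformations dual_aug (def_dual i) (def_dual j)"
  have bil: "bilinear_map (*s) heisenberg" "bilinear_map (*s) (phi k)" for k
    by (simp_all add: heisenberg_def phi_def bilinear_of_table_def bilinear_bilinear_of)
  obtain g where g: "module_hom (*s) (*s) g"
    and eq: "\<And>x y. phi i x y - phi j x y =
      heisenberg (g x) y + heisenberg x (g y) - g (heisenberg x y)"
    using equivalent_imp_cohomologous[OF bil(1) bil(2) bil(2)] equiv unfolding def_dual_def by blast
  have "class_coord i (phi i) - class_coord i (phi j) = 0"
    using class_coord_coboundary[OF g assms(1)]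
    by (simp add: class_coord_diff[OF assms(1), symmetric] eq)
  then show False using assms by (simp add: class_coord_phi)
qed

section \<open>The eight deformations\<close>

interpretation poly: augmented_algebra "\<lambda>c. [:c:]" "\<lambda>p :: complex poly. poly p 0"
  by unfold_locales simp_all

interpretation fps: augmented_algebra fps_const "\<lambda>f :: complex fps. fps_nth f 0"
  by unfold_locales (simp_all add: fps_const_add fps_const_mult)

lemma def_dual_eq_pencil: "i \<in> {1..8} \<Longrightarrow> def_dual i = pencil i 1 dual_t"
  and def_poly_eq_pencil: "i \<in> {1..8} \<Longrightarrow> def_poly i = pencil i 1 [:0, 1:]"
  and def_fps_eq_pencil: "i \<in> {1..8} \<Longrightarrow> def_fps i = pencil i 1 fps_X"
  by (simp_all add: def_dual_def def_poly_def def_fps_def dual.perturbed_eq_pencil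
      poly.perturbed_eq_pencil fps.perturbed_eq_pencil)

lemmas deformations_eq_pencil =
  def_dual_eq_pencil def_poly_eq_pencil def_fps_eq_pencil def_at_eq_pencil

lemma dual_t_neq_0: "dual_t \<noteq> 0"
  using dual_coeff_simps(4,5) by force

theorem mainTheorem2:
  shows
    "((\<forall>i\<in>{1..8}. infinitesimal_deformation dual_unit dual_aug heisenberg (def_dual i)) \<and>
      (\<forall>i\<in>{1..8}. \<forall>j\<in>{1..8}. i \<noteq> j \<longrightarrow>
         \<not> equivalent_deformations dual_aug (def_dual i) (def_dual j))) \<and>
     (\<forall>i\<in>{1..8}.
        cochain_bracket (phi i) (phi i) = (\<lambda>x y z. 0) \<and>
        leibniz_deformation (\<lambda>c. [:c:]) (\<lambda>p. poly p 0) heisenberg (def_poly i) \<and>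
        leibniz_deformation fps_const (\<lambda>f. fps_nth f 0) heisenberg (def_fps i) \<and>
        (\<forall>t. leibniz_algebra (*s) (def_at t i))) \<and>
     ((\<forall>i\<in>{1..5}.
         lie_algebra (*s) (def_dual i) \<and> lie_algebra (*s) (def_poly i) \<and>
         lie_algebra (*s) (def_fps i) \<and> (\<forall>t. lie_algebra (*s) (def_at t i))) \<and>
      (\<forall>i\<in>{6..8}.
         \<not> lie_algebra (*s) (def_dual i) \<and> \<not> lie_algebra (*s) (def_poly i) \<and>
         \<not> lie_algebra (*s) (def_fps i) \<and> (\<forall>t. t \<noteq> 0 \<longrightarrow> \<not> lie_algebra (*s) (def_at t i)) \<and>
         nilpotent_leibniz (*s) (def_dual i) \<and> nilpotent_leibniz (*s) (def_poly i) \<and>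
         nilpotent_leibniz (*s) (def_fps i) \<and> (\<forall>t. nilpotent_leibniz (*s) (def_at t i))))"
proof (intro conjI ballI allI impI)
  fix i :: nat
  assume i: "i \<in> {1..8}"
  show "infinitesimal_deformation dual_unit dual_aug heisenberg (def_dual i)"
    unfolding infinitesimal_deformation_def def_dual_def
    by (intro conjI dual.leibniz_deformation_phi i dual_aug_t infinitesimal_base_dual)
  show "\<not> equivalent_deformations dual_aug (def_dual i) (def_dual j)"
    if "j \<in> {1..8}" "i \<noteq> j" for j
    using not_equivalent_phi i that .
  show "cochain_bracket (phi i) (phi i) = (\<lambda>x y z. 0)"
    by (rule cochain_bracket_phi[OF i])
  show "leibniz_deformation (\<lambda>c. [:c:]) (\<lambda>p. poly p 0) heisenberg (def_poly i)"
    unfolding def_poly_def by (rule poly.leibniz_deformation_phi[OF i]) simp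
  show "leibniz_deformation fps_const (\<lambda>f. fps_nth f 0) heisenberg (def_fps i)"
    unfolding def_fps_def by (rule fps.leibniz_deformation_phi[OF i]) simp
  show "leibniz_algebra (*s) (def_at t i)" for t
    by (simp add: def_at_eq_pencil[OF i] leibniz_pencil[OF i])
next
  fix i :: nat
  assume i: "i \<in> {1..5}"
  then have "i \<in> {1..8}" by auto
  note eqs = deformations_eq_pencil[OF this]
  show "lie_algebra (*s) (def_dual i)" "lie_algebra (*s) (def_poly i)"
      "lie_algebra (*s) (def_fps i)" "lie_algebra (*s) (def_at t i)" for t
    by (simp_all only: eqs lie_pencil[OF i])
next
  fix i :: nat
  assume i: "i \<in> {6..8}"
  then have "i \<in> {1..8}" by auto
  note eqs = deformations_eq_pencil[OF this]
  show "\<not> lie_algebra (*s) (def_dual i)" "\<not> lie_algebra (*s) (def_poly i)"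
      "\<not> lie_algebra (*s) (def_fps i)"
    by (simp_all add: eqs not_lie_pencil[OF i] dual_t_neq_0)
  show "\<not> lie_algebra (*s) (def_at t i)" if "t \<noteq> 0" for t
    using not_lie_pencil[OF i that] by (simp add: eqs)
  show "nilpotent_leibniz (*s) (def_dual i)" "nilpotent_leibniz (*s) (def_poly i)"
      "nilpotent_leibniz (*s) (def_fps i)" "nilpotent_leibniz (*s) (def_at t i)" for t
    by (simp_all only: eqs nilpotent_pencil[OF i])
qed

end
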